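(* Let $X$ be a real vector space ordered by a cone $K$ and let $u\in K\setminus\{0\}$. Then the Thompson metric $d$ and the seminorm $|\cdot|_u$ are topologically equivalent on $K(u)$ (that is, they generate the same topology on $K(u)$).
   Context: A cone $K$ in a real vector space $X$ is a nonempty subset with $K+K\subset K$, $tK\subset K$ for all $t\ge 0$, and $K\cap(-K)=\{0\}$; it induces the order $x\le y\iff y-x\in K$, and $[x;y]_o=\{z: x\le z\le y\}$. Two elements $x,y\in K$ are linked if there are $\lambda,\mu>0$ with $x\le\lambda y$ and $y\le\mu x$; this is an equivalence relation on $K$, and $K(u)$ denotes the class (component) of $u$. The Thompson metric is $d(x,y)=\inf\{s\ge 0: e^{-s}x\le y\le e^{s}x\}$ (a finite semimetric, i.e. pseudometric, on $K(u)$). For $u\in K\setminus\{0\}$: $X_u=\bigcup_{\lambda\ge 0}\lambda[-u;u]_o$, a vector subspace of $X$ containing $K(u)$, and $|x|_u=\inf\{\lambda>0: x\in\lambda[-u;u]_o\}$ for $x\in X_u$, a seminorm on $X_u$. *)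

theory Defs
  imports "HOL-Analysis.Analysis"
begin

definition order_cone :: "'a::real_vector set \<Rightarrow> bool" where
  "order_cone K \<longleftrightarrow>
     K \<noteq> {} \<and>
     (\<forall>x\<in>K. \<forall>y\<in>K. x + y \<in> K) \<and>
     (\<forall>t\<ge>0. \<forall>x\<in>K. t *\<^sub>R x \<in> K) \<and>
     K \<inter> uminus ` K = {0}"

definition cone_le :: "'a::real_vector set \<Rightarrow> 'a \<Rightarrow> 'a \<Rightarrow> bool" where
  "cone_le K x y \<longleftrightarrow> y - x \<in> K"

definition order_interval :: "'a::real_vector set \<Rightarrow> 'a \<Rightarrow> 'a \<Rightarrow> 'a set" where
  "order_interval K x y = {z. cone_le K x z \<and> cone_le K z y}"

definition linked :: "'a::real_vector set \<Rightarrow> 'a \<Rightarrow> 'a \<Rightarrow> bool" where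
  "linked K x y \<longleftrightarrow>
     (\<exists>l>0. \<exists>m>0. cone_le K x (l *\<^sub>R y) \<and> cone_le K y (m *\<^sub>R x))"

definition cone_component :: "'a::real_vector set \<Rightarrow> 'a \<Rightarrow> 'a set" where
  "cone_component K u = {x \<in> K. linked K x u}"

text \<open>On each component the set below is nonempty, so the real-valued infimum is the
  intended one. For unlinked arguments the set is empty and the value is unspecified.\<close>

definition thompson_dist :: "'a::real_vector set \<Rightarrow> 'a \<Rightarrow> 'a \<Rightarrow> real" where
  "thompson_dist K x y =
     Inf {s. 0 \<le> s \<and> cone_le K (exp (- s) *\<^sub>R x) y \<and> cone_le K y (exp s *\<^sub>R x)}"

definition order_unit_space :: "'a::real_vector set \<Rightarrow> 'a \<Rightarrow> 'a set" where
  "order_unit_space K u = (\<Union>l\<in>{0..}. (*\<^sub>R) l ` order_interval K (- u) u)"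

text \<open>Only meaningful for \<open>x\<close> in \<^const>\<open>order_unit_space\<close>; elsewhere the set is empty.\<close>

definition order_unit_seminorm :: "'a::real_vector set \<Rightarrow> 'a \<Rightarrow> 'a \<Rightarrow> real" where
  "order_unit_seminorm K u x = Inf {l. 0 < l \<and> x \<in> (*\<^sub>R) l ` order_interval K (- u) u}"

text \<open>The locale \<^locale>\<open>Metric_space\<close> requires points at distance zero to be equal, which
  can fail for the Thompson semimetric and the seminorm when the cone is not Archimedean. The
  topology is therefore defined for an arbitrary distance function, by the same condition on
  open sets as the topology of a metric space.\<close>

definition semimetric_topology :: "'a set \<Rightarrow> ('a \<Rightarrow> 'a \<Rightarrow> real) \<Rightarrow> 'a topology" where
  "semimetric_topology S d =
     topology (\<lambda>U. U \<subseteq> S \<and> (\<forall>x\<in>U. \<exists>r>0. {y \<in> S. d x y < r} \<subseteq> U))"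

lemma openin_semimetric_topology:
  "openin (semimetric_topology S d) U \<longleftrightarrow>
     U \<subseteq> S \<and> (\<forall>x\<in>U. \<exists>r>0. {y \<in> S. d x y < r} \<subseteq> U)"
proof -
  have "istopology (\<lambda>U. U \<subseteq> S \<and> (\<forall>x\<in>U. \<exists>r>0. {y \<in> S. d x y < r} \<subseteq> U))"
    unfolding istopology_def
  proof (rule conjI; intro allI impI)
    fix U V
    assume U: "U \<subseteq> S \<and> (\<forall>x\<in>U. \<exists>r>0. {y \<in> S. d x y < r} \<subseteq> U)"
      and V: "V \<subseteq> S \<and> (\<forall>x\<in>V. \<exists>r>0. {y \<in> S. d x y < r} \<subseteq> V)"
    show "U \<inter> V \<subseteq> S \<and> (\<forall>x\<in>U \<inter> V. \<exists>r>0. {y \<in> S. d x y < r} \<subseteq> U \<inter> V)"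
    proof (intro conjI ballI)
      show "U \<inter> V \<subseteq> S" using U by blast
      fix x assume x: "x \<in> U \<inter> V"
      obtain r where "r > 0" "{y \<in> S. d x y < r} \<subseteq> U" using U x by blast
      moreover obtain s where "s > 0" "{y \<in> S. d x y < s} \<subseteq> V" using V x by blast
      ultimately have "min r s > 0" "{y \<in> S. d x y < min r s} \<subseteq> U \<inter> V" by auto
      then show "\<exists>r>0. {y \<in> S. d x y < r} \<subseteq> U \<inter> V" by blast
    qed
  next
    fix \<U>
    assume *: "\<forall>U\<in>\<U>. U \<subseteq> S \<and> (\<forall>x\<in>U. \<exists>r>0. {y \<in> S. d x y < r} \<subseteq> U)"
    show "\<Union>\<U> \<subseteq> S \<and> (\<forall>x\<in>\<Union>\<U>. \<exists>r>0. {y \<in> S. d x y < r} \<subseteq> \<Union>\<U>)"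
    proof (intro conjI ballI)
      show "\<Union>\<U> \<subseteq> S" using * by blast
      fix x assume "x \<in> \<Union>\<U>"
      then obtain U where U: "U \<in> \<U>" "x \<in> U" by blast
      then obtain r where "r > 0" "{y \<in> S. d x y < r} \<subseteq> U" using * by blast
      then show "\<exists>r>0. {y \<in> S. d x y < r} \<subseteq> \<Union>\<U>" using U(1) by blast
    qed
  qed
  then show ?thesis
    by (simp add: semimetric_topology_def)
qed

end

theory Submission
  imports Defs
begin

text \<open>
  If \<open>c u \<le> x\<close> then \<open>- l u \<le> x - y \<le> l u\<close> forces \<open>(1 - l/c) x \<le> y \<le> (1 + l/c) x\<close>,
  so \<open>|x - y|\<^sub>u\<close> small makes \<open>d(x, y)\<close> small; the same inequality puts \<open>y\<close> into \<open>K(u)\<close>,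
  which is therefore open in \<open>X\<^sub>u\<close>. Conversely, if \<open>x \<le> b u\<close> then \<open>e\<^sup>-\<^sup>s x \<le> y \<le> e\<^sup>s x\<close> gives
  \<open>|x - y|\<^sub>u \<le> b (e\<^sup>s - 1)\<close>. Both estimates are local in \<open>x\<close>, which is all that the
  comparison of the topologies needs.
\<close>

section \<open>The order of a cone and the linking relation\<close>

lemma order_cone_add: "order_cone K \<Longrightarrow> x \<in> K \<Longrightarrow> y \<in> K \<Longrightarrow> x + y \<in> K"
  by (auto simp: order_cone_def)

lemma order_cone_scaleR: "order_cone K \<Longrightarrow> 0 \<le> t \<Longrightarrow> x \<in> K \<Longrightarrow> t *\<^sub>R x \<in> K"
  by (auto simp: order_cone_def)

lemma cone_le_trans:
  assumes "order_cone K" "cone_le K x y" "cone_le K y z"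
  shows "cone_le K x z"
  using order_cone_add[OF assms(1), of "y - x" "z - y"] assms(2,3)
  by (simp add: cone_le_def)

lemma cone_le_scaleR:
  assumes "order_cone K" "0 \<le> t" "cone_le K x y"
  shows "cone_le K (t *\<^sub>R x) (t *\<^sub>R y)"
  using order_cone_scaleR[OF assms(1,2), of "y - x"] assms(3)
  by (simp add: cone_le_def scaleR_diff_right)

lemma cone_le_scaleR_left:
  assumes "order_cone K" "s \<le> t" "x \<in> K"
  shows "cone_le K (s *\<^sub>R x) (t *\<^sub>R x)"
  using order_cone_scaleR[OF assms(1), of "t - s" x] assms(2,3)
  by (simp add: cone_le_def scaleR_diff_left)

lemma cone_le_divide:
  assumes "order_cone K" "0 < a" "cone_le K (a *\<^sub>R x) y"
  shows "cone_le K x ((1 / a) *\<^sub>R y)"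
  using cone_le_scaleR[OF assms(1) _ assms(3), of "1 / a"] assms(2) by simp

lemma cone_le_mem:
  assumes "order_cone K" "x \<in> K" "cone_le K x y"
  shows "y \<in> K"
  using order_cone_add[OF assms(1,2), of "y - x"] assms(3) by (simp add: cone_le_def)

lemma linked_sym: "linked K x y \<Longrightarrow> linked K y x"
  by (auto simp: linked_def)

lemma linked_trans:
  assumes K: "order_cone K" and xy: "linked K x y" and yz: "linked K y z"
  shows "linked K x z"
proof -
  obtain l m where lm: "l > 0" "m > 0" "cone_le K x (l *\<^sub>R y)" "cone_le K y (m *\<^sub>R x)"
    using xy by (auto simp: linked_def)
  obtain l' m' where lm': "l' > 0" "m' > 0" "cone_le K y (l' *\<^sub>R z)" "cone_le K z (m' *\<^sub>R y)"
    using yz by (auto simp: linked_def)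
  have "cone_le K x ((l * l') *\<^sub>R z)"
    using cone_le_trans[OF K lm(3)] cone_le_scaleR[OF K _ lm'(3), of l] lm(1) by simp
  moreover have "cone_le K z ((m' * m) *\<^sub>R x)"
    using cone_le_trans[OF K lm'(4)] cone_le_scaleR[OF K _ lm(4), of m'] lm'(2) by simp
  ultimately show ?thesis
    using lm(1,2) lm'(1,2) unfolding linked_def by (meson mult_pos_pos)
qed

section \<open>Multiples of the order interval and the space \<open>X_u\<close>\<close>

lemma mem_scaled_order_interval_iff:
  assumes K: "order_cone K" and l: "0 < l"
  shows "z \<in> (*\<^sub>R) l ` order_interval K (- u) u \<longleftrightarrow>
    cone_le K z (l *\<^sub>R u) \<and> cone_le K (- z) (l *\<^sub>R u)"
proof
  assume "z \<in> (*\<^sub>R) l ` order_interval K (- u) u"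
  then obtain w where w: "z = l *\<^sub>R w" "cone_le K (- u) w" "cone_le K w u"
    by (auto simp: order_interval_def)
  have "cone_le K (- w) u"
    using w(2) by (simp add: cone_le_def add.commute)
  from cone_le_scaleR[OF K _ this, of l] cone_le_scaleR[OF K _ w(3), of l] w(1) l
  show "cone_le K z (l *\<^sub>R u) \<and> cone_le K (- z) (l *\<^sub>R u)" by simp
next
  assume z: "cone_le K z (l *\<^sub>R u) \<and> cone_le K (- z) (l *\<^sub>R u)"
  define w where "w = (1 / l) *\<^sub>R z"
  have "cone_le K w u" "cone_le K (- w) u"
    using cone_le_scaleR[OF K, of "1 / l"] z l by (force simp: w_def)+
  then have "w \<in> order_interval K (- u) u"
    by (simp add: order_interval_def cone_le_def add.commute)
  moreover have "z = l *\<^sub>R w" using l by (simp add: w_def)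
  ultimately show "z \<in> (*\<^sub>R) l ` order_interval K (- u) u" by blast
qed

text \<open>Bounding \<open>z\<close> and \<open>- z\<close> from above by the same multiple of
  \<open>u\<close> lets transitivity and addition handle both sides alike. Requiring a positive
  factor loses nothing: the factor 0 contributes only \<open>z = 0\<close>, which also satisfies the
  bounds with factor 1.\<close>

lemma mem_order_unit_space_iff:
  assumes K: "order_cone K" and u: "u \<in> K"
  shows "z \<in> order_unit_space K u \<longleftrightarrow>
    (\<exists>l>0. cone_le K z (l *\<^sub>R u) \<and> cone_le K (- z) (l *\<^sub>R u))"
proof
  assume "z \<in> order_unit_space K u"
  then obtain l where l: "0 \<le> l" "z \<in> (*\<^sub>R) l ` order_interval K (- u) u"
    by (auto simp: order_unit_space_def)
  show "\<exists>l>0. cone_le K z (l *\<^sub>R u) \<and> cone_le K (- z) (l *\<^sub>R u)"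
  proof (cases "l = 0")
    case True
    with l(2) have "z = 0" by auto
    with u have "cone_le K z (1 *\<^sub>R u) \<and> cone_le K (- z) (1 *\<^sub>R u)"
      by (simp add: cone_le_def)
    then show ?thesis using zero_less_one by blast
  next
    case False
    with l mem_scaled_order_interval_iff[OF K, of l] show ?thesis
      by (metis order_le_less)
  qed
next
  assume "\<exists>l>0. cone_le K z (l *\<^sub>R u) \<and> cone_le K (- z) (l *\<^sub>R u)"
  then show "z \<in> order_unit_space K u"
    using mem_scaled_order_interval_iff[OF K] by (force simp: order_unit_space_def)
qed

text \<open>Each bound for \<open>x\<close> is added to the opposite bound for \<open>y\<close>.
  This ensures that the infimum defining the seminorm of \<open>x - y\<close> is taken over a
  nonempty set.\<close>

lemma order_unit_space_diff:
  assumes K: "order_cone K" and u: "u \<in> K"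
    and x: "x \<in> order_unit_space K u" and y: "y \<in> order_unit_space K u"
  shows "x - y \<in> order_unit_space K u"
proof -
  obtain l where l: "l > 0" "l *\<^sub>R u - x \<in> K" "l *\<^sub>R u + x \<in> K"
    using x unfolding mem_order_unit_space_iff[OF K u] by (auto simp: cone_le_def)
  obtain m where m: "m > 0" "m *\<^sub>R u - y \<in> K" "m *\<^sub>R u + y \<in> K"
    using y unfolding mem_order_unit_space_iff[OF K u] by (auto simp: cone_le_def)
  have "cone_le K (x - y) ((l + m) *\<^sub>R u)" "cone_le K (- (x - y)) ((l + m) *\<^sub>R u)"
    using order_cone_add[OF K l(2) m(3)] order_cone_add[OF K l(3) m(2)]
    by (simp_all add: cone_le_def algebra_simps)
  with l(1) m(1) show ?thesis
    unfolding mem_order_unit_space_iff[OF K u] by (metis add_pos_pos)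
qed

lemma cone_component_subset_order_unit_space:
  assumes K: "order_cone K" and u: "u \<in> K"
  shows "cone_component K u \<subseteq> order_unit_space K u"
proof
  fix x assume "x \<in> cone_component K u"
  then obtain l where x: "x \<in> K" and l: "l > 0" "cone_le K x (l *\<^sub>R u)"
    by (auto simp: cone_component_def linked_def)
  \<comment> \<open>This says that \<open>l u + x\<close> lies in \<open>K\<close>, a sum of two
    cone elements.\<close>
  have "cone_le K (- x) (l *\<^sub>R u)"
    using order_cone_add[OF K order_cone_scaleR[OF K _ u] x] l(1) by (simp add: cone_le_def)
  with l show "x \<in> order_unit_space K u"
    unfolding mem_order_unit_space_iff[OF K u] by blast
qed

section \<open>From the two infima to order inequalities and back\<close>

lemma order_unit_seminorm_le:
  assumes "order_cone K" "0 < l" "cone_le K z (l *\<^sub>R u)" "cone_le K (- z) (l *\<^sub>R u)"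
  shows "order_unit_seminorm K u z \<le> l"
  unfolding order_unit_seminorm_def using assms
  by (intro cInf_lower) (auto simp: mem_scaled_order_interval_iff intro!: bdd_belowI[of _ 0])

text \<open>Membership in \<open>order_unit_space K u\<close> makes the set of factors nonempty, so
  an infimum below \<open>e\<close> yields a factor below \<open>e\<close>.\<close>

lemma order_unit_seminorm_lessD:
  assumes K: "order_cone K" and u: "u \<in> K" and z: "z \<in> order_unit_space K u"
    and less: "order_unit_seminorm K u z < e"
  shows "\<exists>l. 0 < l \<and> l < e \<and> cone_le K z (l *\<^sub>R u) \<and> cone_le K (- z) (l *\<^sub>R u)"
proof -
  have "{l. 0 < l \<and> z \<in> (*\<^sub>R) l ` order_interval K (- u) u} \<noteq> {}"
    using z mem_scaled_order_interval_iff[OF K] unfolding mem_order_unit_space_iff[OF K u] by blast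
  from cInf_lessD[OF this less[unfolded order_unit_seminorm_def]]
  show ?thesis using mem_scaled_order_interval_iff[OF K] by blast
qed

lemma thompson_dist_le:
  assumes "0 \<le> s" "cone_le K (exp (- s) *\<^sub>R x) y" "cone_le K y (exp s *\<^sub>R x)"
  shows "thompson_dist K x y \<le> s"
  unfolding thompson_dist_def using assms
  by (intro cInf_lower) (auto intro!: bdd_belowI[of _ 0])

lemma thompson_dist_lessD:
  assumes K: "order_cone K" and x: "x \<in> K" and y: "y \<in> K" and xy: "linked K x y"
    and less: "thompson_dist K x y < e"
  shows "\<exists>s. 0 \<le> s \<and> s < e \<and> cone_le K (exp (- s) *\<^sub>R x) y \<and> cone_le K y (exp s *\<^sub>R x)"
proof -
  obtain l m where lm: "l > 0" "m > 0" "cone_le K x (l *\<^sub>R y)" "cone_le K y (m *\<^sub>R x)"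
    using xy by (auto simp: linked_def)
  \<comment> \<open>The least nonnegative \<open>s\<close> for which \<open>exp s\<close> dominates
    both linking constants; it witnesses that the set under the infimum is nonempty.\<close>
  define s where "s = max 0 (max (ln l) (ln m))"
  have "exp (ln l) \<le> exp s" "exp (ln m) \<le> exp s"
    unfolding exp_le_cancel_iff s_def by linarith+
  then have "l \<le> exp s" "m \<le> exp s"
    using lm(1,2) by simp_all
  have "cone_le K y (exp s *\<^sub>R x)"
    using cone_le_trans[OF K lm(4)] cone_le_scaleR_left[OF K \<open>m \<le> exp s\<close> x] by blast
  moreover have "cone_le K x (exp s *\<^sub>R y)"
    using cone_le_trans[OF K lm(3)] cone_le_scaleR_left[OF K \<open>l \<le> exp s\<close> y] by blast
  then have "cone_le K (exp (- s) *\<^sub>R x) y"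
    using cone_le_scaleR[OF K, of "exp (- s)" x "exp s *\<^sub>R y"] by (simp flip: exp_add)
  moreover have "0 \<le> s" by (simp add: s_def)
  ultimately have "{s. 0 \<le> s \<and> cone_le K (exp (- s) *\<^sub>R x) y \<and> cone_le K y (exp s *\<^sub>R x)} \<noteq> {}"
    by blast
  from cInf_lessD[OF this less[unfolded thompson_dist_def]] show ?thesis by blast
qed

section \<open>Local comparison of the two distances\<close>

lemma thompson_dist_small_if_seminorm_small:
  assumes K: "order_cone K" and u: "u \<in> K" and x: "x \<in> cone_component K u" and r: "0 < r"
  shows "\<exists>e>0. \<forall>y\<in>order_unit_space K u. order_unit_seminorm K u (x - y) < e \<longrightarrow>
    y \<in> cone_component K u \<and> thompson_dist K x y < r"
proof -
  obtain m where xK: "x \<in> K" and xu: "linked K x u" and m: "m > 0" "cone_le K u (m *\<^sub>R x)"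
    using x by (auto simp: cone_component_def linked_def)
  \<comment> \<open>The distance will only be shown to be at most \<open>s\<close>, so halving
    \<open>r\<close> gives the strict bound.\<close>
  define s where "s = r / 2"
  have s: "0 < s" "s < r" using r by (simp_all add: s_def)
  \<comment> \<open>Since \<open>u \<le> m x\<close>, a factor \<open>l < e\<close> bounds both
    \<open>x - y\<close> and \<open>y - x\<close> by \<open>l m x\<close> with
    \<open>l m \<le> s / (1 + s)\<close>.\<close>
  define e where "e = s / ((1 + s) * m)"
  have "e > 0" using s m by (simp add: e_def)
  \<comment> \<open>Here \<open>y\<close> is any point of \<open>X_u\<close>; that it lies in the
    component is part of what is proved.\<close>
  moreover have "y \<in> cone_component K u \<and> thompson_dist K x y < r"
    if y: "y \<in> order_unit_space K u" and less: "order_unit_seminorm K u (x - y) < e" for y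
  proof -
    have "x - y \<in> order_unit_space K u"
      using order_unit_space_diff[OF K u] cone_component_subset_order_unit_space[OF K u] x y
      by blast
    then obtain l where l: "0 < l" "l < e"
      "cone_le K (x - y) (l *\<^sub>R u)" "cone_le K (- (x - y)) (l *\<^sub>R u)"
      using order_unit_seminorm_lessD[OF K u _ less] by blast
    have lx: "cone_le K (l *\<^sub>R u) ((l * m) *\<^sub>R x)"
      using cone_le_scaleR[OF K _ m(2), of l] l(1) by simp
    have "l * m \<le> e * m" using l(2) m(1) by simp
    then have lm: "l * m \<le> s / (1 + s)" using m(1) by (simp add: e_def)
    \<comment> \<open>The inequality \<open>1 + s \<le> exp s\<close> serves both sides: inverted,
      it gives \<open>exp (- s) \<le> 1 - s / (1 + s)\<close>; as it stands, it gives
      \<open>1 + l m \<le> exp s\<close> because \<open>s / (1 + s) \<le> s\<close>.\<close>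
    have "s / (1 + s) = 1 - 1 / (1 + s)" using s by (simp add: field_simps)
    moreover have "s / (1 + s) \<le> s / 1" using s by (intro divide_left_mono) auto
    moreover have "exp (- s) \<le> 1 / (1 + s)"
      using exp_ge_add_one_self[of s] s by (simp add: exp_minus field_simps)
    ultimately have bounds: "exp (- s) \<le> 1 - l * m" "1 + l * m \<le> exp s"
      using lm exp_ge_add_one_self[of s] by linarith+
    have "cone_le K ((1 - l * m) *\<^sub>R x) y"
      using cone_le_trans[OF K l(3) lx] by (simp add: cone_le_def algebra_simps)
    then have lower: "cone_le K (exp (- s) *\<^sub>R x) y"
      using cone_le_trans[OF K cone_le_scaleR_left[OF K bounds(1) xK]] by blast
    have "cone_le K y ((1 + l * m) *\<^sub>R x)"
      using cone_le_trans[OF K l(4) lx] by (simp add: cone_le_def algebra_simps)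
    then have upper: "cone_le K y (exp s *\<^sub>R x)"
      using cone_le_trans[OF K _ cone_le_scaleR_left[OF K bounds(2) xK]] by blast
    have "y \<in> K"
      using cone_le_mem[OF K order_cone_scaleR[OF K _ xK] lower] by simp
    \<comment> \<open>Dividing the lower estimate by \<open>exp (- s)\<close> bounds
      \<open>x\<close> by a multiple of \<open>y\<close>.\<close>
    moreover have "linked K y x"
      using upper cone_le_divide[OF K _ lower] unfolding linked_def
      by (meson exp_gt_zero zero_less_divide_1_iff)
    then have "linked K y u" using linked_trans[OF K _ xu] by blast
    moreover have "thompson_dist K x y < r"
      using thompson_dist_le[OF _ lower upper] s by simp
    ultimately show ?thesis by (simp add: cone_component_def)
  qed
  ultimately show ?thesis by blast
qed

lemma seminorm_small_if_thompson_dist_small: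
  assumes K: "order_cone K" and u: "u \<in> K" and x: "x \<in> cone_component K u" and r: "0 < r"
  shows "\<exists>e>0. \<forall>y\<in>cone_component K u. thompson_dist K x y < e \<longrightarrow>
    order_unit_seminorm K u (x - y) < r"
proof -
  obtain b where xK: "x \<in> K" and xu: "linked K x u" and b: "b > 0" "cone_le K x (b *\<^sub>R u)"
    using x by (auto simp: cone_component_def linked_def)
  \<comment> \<open>Chosen so that \<open>exp e - 1 = r / (2 b)\<close>: with
    \<open>x \<le> b u\<close>, this makes \<open>(exp s - 1) x \<le> (r / 2) u\<close> for
    \<open>s < e\<close>.\<close>
  define e where "e = ln (1 + r / (2 * b))"
  have "e > 0" using r b(1) unfolding e_def by (intro ln_gt_zero) simp
  moreover have "order_unit_seminorm K u (x - y) < r"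
    if y: "y \<in> cone_component K u" and less: "thompson_dist K x y < e" for y
  proof -
    have yK: "y \<in> K" and xy: "linked K x y"
      using y linked_trans[OF K xu] by (auto simp: cone_component_def dest: linked_sym)
    obtain s where s: "0 \<le> s" "s < e"
      "cone_le K (exp (- s) *\<^sub>R x) y" "cone_le K y (exp s *\<^sub>R x)"
      using thompson_dist_lessD[OF K xK yK xy less] by blast
    have "exp s < exp e" using s(2) by simp
    also have "exp e = 1 + r / (2 * b)" using r b by (simp add: e_def add_pos_pos)
    finally have es: "exp s - 1 \<le> r / (2 * b)" by simp
    \<comment> \<open>Adding \<open>1 + s \<le> exp s\<close> and
      \<open>1 - s \<le> exp (- s)\<close> gives \<open>1 - exp (- s) \<le> exp s - 1\<close>, so
      one constant controls both errors.\<close>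
    have e1: "1 - exp (- s) \<le> r / (2 * b)"
      using es exp_ge_add_one_self[of s] exp_ge_add_one_self[of "- s"] by linarith
    have "cone_le K ((r / (2 * b)) *\<^sub>R x) ((r / 2) *\<^sub>R u)"
      using cone_le_scaleR[OF K _ b(2), of "r / (2 * b)"] r b(1) by simp
    then have small: "cone_le K (t *\<^sub>R x) ((r / 2) *\<^sub>R u)" if "t \<le> r / (2 * b)" for t
      using cone_le_trans[OF K cone_le_scaleR_left[OF K that xK]] by blast
    have "cone_le K (x - y) ((1 - exp (- s)) *\<^sub>R x)" "cone_le K (- (x - y)) ((exp s - 1) *\<^sub>R x)"
      using s(3,4) by (simp_all add: cone_le_def algebra_simps)
    then have "cone_le K (x - y) ((r / 2) *\<^sub>R u)" "cone_le K (- (x - y)) ((r / 2) *\<^sub>R u)"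
      using small[OF e1] small[OF es] cone_le_trans[OF K] by blast+
    then have "order_unit_seminorm K u (x - y) \<le> r / 2"
      using r by (intro order_unit_seminorm_le[OF K]) simp_all
    then show ?thesis using r by simp
  qed
  ultimately show ?thesis by blast
qed

theorem theorem3p23:
  fixes K :: "'a::real_vector set" and u :: 'a
  assumes "order_cone K" and "u \<in> K - {0}"
  shows "semimetric_topology (cone_component K u) (thompson_dist K) =
         subtopology
           (semimetric_topology (order_unit_space K u)
             (\<lambda>x y. order_unit_seminorm K u (x - y)))
           (cone_component K u)"
proof -
  have u: "u \<in> K" using assms(2) by blast
  let ?C = "cone_component K u" and ?X = "order_unit_space K u"
  let ?T = "semimetric_topology ?X (\<lambda>x y. order_unit_seminorm K u (x - y))"
  have sub: "?C \<subseteq> ?X"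
    using cone_component_subset_order_unit_space[OF assms(1) u] .
  have "openin (semimetric_topology ?C (thompson_dist K)) U \<longleftrightarrow> openin (subtopology ?T ?C) U"
    for U
  proof
    assume "openin (semimetric_topology ?C (thompson_dist K)) U"
    then have UC: "U \<subseteq> ?C"
      and U: "\<And>x. x \<in> U \<Longrightarrow> \<exists>r>0. {y \<in> ?C. thompson_dist K x y < r} \<subseteq> U"
      by (auto simp: openin_semimetric_topology)
    have "\<exists>e>0. {y \<in> ?X. order_unit_seminorm K u (x - y) < e} \<subseteq> U" if x: "x \<in> U" for x
    proof -
      obtain r where r: "r > 0" "{y \<in> ?C. thompson_dist K x y < r} \<subseteq> U"
        using U[OF x] by blast
      have "x \<in> ?C" using x UC by blast
      from thompson_dist_small_if_seminorm_small[OF assms(1) u this r(1)] r(2)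
      show ?thesis by (smt (verit) mem_Collect_eq subset_iff)
    qed
    \<comment> \<open>The seminorm balls found in \<open>?X\<close> stay inside \<open>U\<close>, so
      \<open>U\<close> is its own witness for the subspace topology.\<close>
    then have "openin ?T U"
      using UC sub by (auto simp: openin_semimetric_topology)
    then show "openin (subtopology ?T ?C) U"
      using UC unfolding openin_subtopology by blast
  next
    assume "openin (subtopology ?T ?C) U"
    then obtain V where UV: "U = V \<inter> ?C"
      and V: "\<And>x. x \<in> V \<Longrightarrow> \<exists>r>0. {y \<in> ?X. order_unit_seminorm K u (x - y) < r} \<subseteq> V"
      by (auto simp: openin_subtopology openin_semimetric_topology)
    \<comment> \<open>The estimate places the Thompson ball inside \<open>V\<close>; its points are
      in \<open>?C\<close> by definition, hence in \<open>U\<close>.\<close>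
    have "\<exists>e>0. {y \<in> ?C. thompson_dist K x y < e} \<subseteq> U" if x: "x \<in> U" for x
    proof -
      obtain r where r: "r > 0" "{y \<in> ?X. order_unit_seminorm K u (x - y) < r} \<subseteq> V"
        using V x UV by blast
      have "x \<in> ?C" using x UV by blast
      from seminorm_small_if_thompson_dist_small[OF assms(1) u this r(1)] r(2) sub UV
      show ?thesis by (smt (verit) IntI mem_Collect_eq subset_iff)
    qed
    then show "openin (semimetric_topology ?C (thompson_dist K)) U"
      using UV by (auto simp: openin_semimetric_topology)
  qed
  then show ?thesis by (simp add: topology_eq)
qed

end
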